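(* Let $r>0$ and suppose the points $x^t$ are generated by the ACGD method (described in the context) with the following stepsizes for $t\ge 1$: $$\tau_t=\min\{\tfrac{t-1}{2},\sqrt{\kappa_r}\},\quad \eta_t=\frac{L(\Lambda_r)}{\tau_{t+1}},\quad \theta_t=\frac{\tau_t}{\tau_{t-1}+1},\quad \omega_t=\begin{cases}\omega_{t-1}/\theta_t & t\ge 2,\\ 1 & t=1,\end{cases}$$ where $\kappa_r=L(\Lambda_r)/\alpha$ ($\kappa_r=\infty$ if $\alpha=0$). Then the ergodic average $\bar x^N=\sum_{t=1}^N\omega_t x^t/\sum_{t=1}^N\omega_t$ satisfies $$\max\{F(\bar x^N)-F_*,\ r\|[g(\bar x^N)]_+\|\}\le \frac{2L(\Lambda_r)}{N(N+1)}\|x^0-x^*\|^2 .$$ Moreover, in the strongly convex case $\alpha>0$, for every $N\ge 5$, $\bar x^N$ also satisfies $$\max\{F(\bar x^N)-F_*,\ r\|[g(\bar x^N)]_+\|\}\le\frac{\sqrt{L(\Lambda_r)\alpha}\,\|x^0-x^*\|^2}{(1+1/\sqrt{\kappa_r})^{N-4}-1},$$ $$\|\bar x^N-x^*\|^2\le\frac{2\sqrt{\kappa_r}\,\|x^0-x^*\|^2}{(1+1/\sqrt{\kappa_r})^{N-4}-1}.$$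
   Context: Problem: $\min_{x\in X}\{F(x):=f(x)+u(x)\}$ subject to $g(x)\le 0$, where $X\subseteq\mathbb R^n$ is closed and convex, $f:\mathbb R^n\to\mathbb R$ and $g=(g_1,\dots,g_m):\mathbb R^n\to\mathbb R^m$ are convex (componentwise) and differentiable with Lipschitz continuous gradients, and $u$ is a convex, $\alpha$-strongly convex function, $\alpha\ge0$. Norms are Euclidean, $[\cdot]_+$ is the componentwise positive part, $\nabla g(x)$ is the $m\times n$ Jacobian. The set of optimal solutions is nonempty, and there is a KKT pair: $x^*\in X$ optimal, $\lambda^*\in\mathbb R^m_+$ with $-[\nabla f(x^* )+\sum_i\lambda_i^*\nabla g_i(x^* )+u']\in N_X(x^* )$ for some $u'\in\partial u(x^* )$, $g(x^* )\le0$, $\lambda^*_ig_i(x^* )=0$ for all $i$; $F_*=F(x^* )$. Aggregate smoothness: for $\lambda\in\mathbb R^m_+$, $L_\lambda$ is a Lipschitz constant on $\mathbb R^n$ of the gradient of $f+\sum_i\lambda_ig_i$; for $\Lambda\subseteq\mathbb R^m_+$, $L(\Lambda)=\sup_{\lambda\in\Lambda}L_\lambda$. $\Lambda_r=\{0\}\cup\{\lambda^*+\lambda:\lambda\in\mathbb R^m_+,\|\lambda\|\le r\}$. Convention: the Lipschitz constant $L_f$ of $\nabla f$ is chosen with $L_f\ge\alpha$ (constants need not be minimal), so $L(\Lambda_r)\ge\alpha$. ACGD method: given $x^{-1}=\underline x^0=x^0\in X$, stepsizes $\theta_t,\eta_t,\tau_t$ and weights $\omega_t$. For $t=1,\dots,N$: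 set $\tilde x^t=x^{t-1}+\theta_t(x^{t-1}-x^{t-2})$, $\underline x^t=(\tau_t\underline x^{t-1}+\tilde x^t)/(1+\tau_t)$, $\pi^t=\nabla f(\underline x^t)$, $\nu^t=\nabla g(\underline x^t)$, and $$x^t\in\operatorname{argmin}_{x\in X}\{\langle\pi^t,x\rangle+u(x)+\tfrac{\eta_t}{2}\|x-x^{t-1}\|^2:\ \nu^t(x-\underline x^t)+g(\underline x^t)\le0\}.$$ The method identifies this step with the $x$-component of a saddle point $(x^t,\lambda^t)$ of $\min_{x\in X}\max_{\lambda\in\mathbb R^m_+}\langle\pi^t,x\rangle+\langle\lambda,\nu^t(x-\underline x^t)+g(\underline x^t)\rangle+u(x)+\frac{\eta_t}{2}\|x-x^{t-1}\|^2$, i.e. a multiplier $\lambda^t$ is taken to exist. *)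

theory Defs
  imports "HOL-Analysis.Analysis"
begin

definition gradient :: "('a::real_inner \<Rightarrow> real) \<Rightarrow> 'a \<Rightarrow> 'a" where
  "gradient f x = (THE D. GDERIV f x :> D)"

lemma gradient_eqI:
  assumes "GDERIV f x :> D"
  shows "gradient f x = D"
  unfolding gradient_def
proof (rule the_equality)
  show "GDERIV f x :> D" by fact
  fix E assume "GDERIV f x :> E"
  then have "(\<lambda>h. inner h E) = (\<lambda>h. inner h D)"
    using assms has_derivative_unique unfolding gderiv_def by blast
  then have "inner (E - D) E = inner (E - D) D" by meson
  then have "inner (E - D) (E - D) = 0" by (simp add: inner_diff_right)
  then show "E = D" by simp
qed

definition strongly_convex_on :: "'a::real_inner set \<Rightarrow> real \<Rightarrow> ('a \<Rightarrow> real) \<Rightarrow> bool" where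
  "strongly_convex_on D \<alpha> u \<longleftrightarrow>
     convex D \<and>
     (\<forall>x\<in>D. \<forall>y\<in>D. \<forall>s\<in>{0..1}.
        u ((1 - s) *\<^sub>R x + s *\<^sub>R y)
          \<le> (1 - s) * u x + s * u y - \<alpha> / 2 * (s * (1 - s)) * (norm (x - y))\<^sup>2)"

text \<open>The function \<open>u\<close> is regarded as taking the value \<open>+\<infinity>\<close> outside \<open>D\<close>;
  \<open>D = UNIV\<close> gives the subdifferential of a finite function.\<close>

definition subdifferential :: "'a::real_inner set \<Rightarrow> ('a \<Rightarrow> real) \<Rightarrow> 'a \<Rightarrow> 'a set" where
  "subdifferential D u x = {v. \<forall>y\<in>D. u x + inner v (y - x) \<le> u y}"

definition normal_cone :: "'a::real_inner set \<Rightarrow> 'a \<Rightarrow> 'a set" where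
  "normal_cone X x = {v. \<forall>y\<in>X. inner v (y - x) \<le> 0}"

definition pos_part :: "real ^ 'm \<Rightarrow> real ^ 'm" where
  "pos_part v = (\<chi> i. max 0 (v $ i))"

text \<open>Minimisation over \<open>x \<in> A\<close>, maximisation over \<open>y \<in> B\<close>.\<close>

definition is_saddle_point :: "'a set \<Rightarrow> 'b set \<Rightarrow> ('a \<Rightarrow> 'b \<Rightarrow> real) \<Rightarrow> 'a \<Rightarrow> 'b \<Rightarrow> bool" where
  "is_saddle_point A B \<Phi> x y \<longleftrightarrow>
     x \<in> A \<and> y \<in> B \<and> (\<forall>y'\<in>B. \<Phi> x y' \<le> \<Phi> x y) \<and> (\<forall>x'\<in>A. \<Phi> x y \<le> \<Phi> x' y)"

text \<open>The order on \<^typ>\<open>real ^ 'm\<close> is the componentwise one.\<close>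

definition kkt_pair ::
  "(real ^ 'n) set \<Rightarrow> (real ^ 'n) set \<Rightarrow> (real ^ 'n \<Rightarrow> real) \<Rightarrow> (real ^ 'n \<Rightarrow> real) \<Rightarrow>
   (real ^ 'n \<Rightarrow> real ^ 'm) \<Rightarrow> real ^ 'n \<Rightarrow> real ^ 'm \<Rightarrow> bool" where
  "kkt_pair X D f u g x l \<longleftrightarrow>
     x \<in> X \<and> 0 \<le> l \<and> g x \<le> 0 \<and> (\<forall>i. l $ i * g x $ i = 0) \<and>
     (\<exists>u'\<in>subdifferential D u x.
        - (gradient f x + (\<Sum>i\<in>UNIV. l $ i *\<^sub>R gradient (\<lambda>z. g z $ i) x) + u') \<in> normal_cone X x)"

definition multiplier_set :: "real ^ 'm \<Rightarrow> real \<Rightarrow> (real ^ 'm) set" where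
  "multiplier_set l r = {0} \<union> {l + l' | l'. 0 \<le> l' \<and> norm l' \<le> r}"

text \<open>\<open>Lc l\<close> is some, not necessarily the least, Lipschitz constant.\<close>

definition aggregate_lipschitz ::
  "(real ^ 'n \<Rightarrow> real) \<Rightarrow> (real ^ 'n \<Rightarrow> real ^ 'm) \<Rightarrow> (real ^ 'm \<Rightarrow> real) \<Rightarrow> bool" where
  "aggregate_lipschitz f g Lc \<longleftrightarrow>
     (\<forall>l\<ge>0. (Lc l)-lipschitz_on UNIV (gradient (\<lambda>z. f z + (\<Sum>i\<in>UNIV. l $ i * g z $ i))))"

text \<open>The case \<open>\<alpha> = 0\<close> is \<open>\<kappa> = \<infinity>\<close>. Note \<open>\<tau> 0 = -1/2\<close> (the subtraction is in the reals),
  so that \<open>\<theta> 1 = 0\<close>.\<close>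

definition acgd_tau :: "real \<Rightarrow> real \<Rightarrow> nat \<Rightarrow> real" where
  "acgd_tau L \<alpha> t =
     (if \<alpha> = 0 then (real t - 1) / 2 else min ((real t - 1) / 2) (sqrt (L / \<alpha>)))"

definition acgd_eta :: "real \<Rightarrow> real \<Rightarrow> nat \<Rightarrow> real" where
  "acgd_eta L \<alpha> t = L / acgd_tau L \<alpha> (t + 1)"

definition acgd_theta :: "real \<Rightarrow> real \<Rightarrow> nat \<Rightarrow> real" where
  "acgd_theta L \<alpha> t = acgd_tau L \<alpha> t / (acgd_tau L \<alpha> (t - 1) + 1)"

text \<open>The value at \<open>0\<close> is never used.\<close>

fun acgd_omega :: "real \<Rightarrow> real \<Rightarrow> nat \<Rightarrow> real" where
  "acgd_omega L \<alpha> 0 = 1"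
| "acgd_omega L \<alpha> (Suc 0) = 1"
| "acgd_omega L \<alpha> (Suc (Suc t)) = acgd_omega L \<alpha> (Suc t) / acgd_theta L \<alpha> (Suc (Suc t))"

text \<open>The sequence \<open>y\<close> consists of the underlined points. Since \<open>x (t - 2)\<close> uses truncated
  subtraction, for \<open>t = 1\<close> it denotes \<open>x 0\<close>, which is the convention \<open>x\<^sup>-\<^sup>1 = x\<^sup>0\<close>.\<close>

definition acgd_iterates ::
  "(real ^ 'n) set \<Rightarrow> (real ^ 'n \<Rightarrow> real) \<Rightarrow> (real ^ 'n \<Rightarrow> real) \<Rightarrow> (real ^ 'n \<Rightarrow> real ^ 'm) \<Rightarrow>
   (nat \<Rightarrow> real) \<Rightarrow> (nat \<Rightarrow> real) \<Rightarrow> (nat \<Rightarrow> real) \<Rightarrow> nat \<Rightarrow>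
   (nat \<Rightarrow> real ^ 'n) \<Rightarrow> (nat \<Rightarrow> real ^ 'n) \<Rightarrow> bool" where
  "acgd_iterates X f u g \<tau> \<eta> \<theta> N x y \<longleftrightarrow>
     x 0 \<in> X \<and> y 0 = x 0 \<and>
     (\<forall>t\<in>{1..N}.
        let xt = x (t - 1) + \<theta> t *\<^sub>R (x (t - 1) - x (t - 2));
            p = gradient f (y t);
            \<nu> = jacobian g (at (y t));
            h = (\<lambda>z. inner p z + u z + \<eta> t / 2 * (norm (z - x (t - 1)))\<^sup>2);
            c = (\<lambda>z. \<nu> *v (z - y t) + g (y t))
        in y t = (\<tau> t *\<^sub>R y (t - 1) + xt) /\<^sub>R (1 + \<tau> t) \<and>
           is_arg_min h (\<lambda>z. z \<in> X \<and> c z \<le> 0) (x t) \<and>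
           (\<exists>l. is_saddle_point X {l. 0 \<le> l} (\<lambda>z l. h z + inner l (c z)) (x t) l))"

definition ergodic_average :: "(nat \<Rightarrow> real) \<Rightarrow> (nat \<Rightarrow> 'a::real_vector) \<Rightarrow> nat \<Rightarrow> 'a" where
  "ergodic_average \<omega> x N = (\<Sum>t=1..N. \<omega> t *\<^sub>R x t) /\<^sub>R (\<Sum>t=1..N. \<omega> t)"

end

theory Submission
  imports Defs
begin

text \<open>
  Fix a multiplier \<open>l \<ge> 0\<close> and let \<open>\<phi> = f + \<langle>l, g\<rangle>\<close>. The quadratic subproblem that defines \<open>x t\<close> is a
  saddle problem. Its optimality condition, compared with the feasible solution \<open>xs\<close>, bounds the
  tangent of \<open>\<phi>\<close> at \<open>y t\<close>, evaluated at \<open>x t\<close>, plus \<open>u (x t)\<close> by \<open>F xs\<close> and distance terms that do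
  not involve \<open>l\<close> (\<open>saddle_prox_inequality\<close>). So one run of the method is an accelerated
  gradient method simultaneously for all the functions \<open>\<phi> + u\<close>, and for each \<open>\<phi>\<close> whose gradient is
  \<open>L\<close>-Lipschitz the usual analysis applies.

  That analysis (\<open>accelerated_gap\<close>) moves from the tangents at the points \<open>y t\<close> to the tangent at a
  single point \<open>a\<close>. The differences telescope in Bregman distances of \<open>\<phi>\<close>, and the errors made by
  extrapolation are absorbed by smoothness. If \<open>a\<close> is the weighted average \<open>xbar\<close> of the iterates,
  the values at the \<open>x t\<close> of the tangent at \<open>a\<close> average to \<open>\<phi> xbar\<close>. With \<open>S = \<Sum> \<omega> t\<close> this gives
  \<open>\<phi> xbar + u xbar - F xs \<le> L \<parallel>x 0 - xs\<parallel>\<^sup>2 / S\<close> (\<open>acgd_lagrangian_gap\<close>).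

  Three choices of \<open>l\<close> finish the proof. The choice \<open>l = 0\<close> bounds the optimality gap. For
  \<open>l = ls + l'\<close>, where \<open>l'\<close> has norm \<open>r\<close> and points in the direction of \<open>pos_part (g xbar)\<close>, the term
  \<open>\<langle>l', g xbar\<rangle>\<close> is \<open>r\<close> times the infeasibility, and the rest is at least \<open>F xs\<close> because \<open>xs\<close> minimises
  the Lagrangian at \<open>ls\<close>. For \<open>l = ls\<close>, that Lagrangian grows quadratically away from \<open>xs\<close>
  (\<open>kkt_lagrangian_growth\<close>), which bounds the distance.

  The two rates are two lower bounds of \<open>S\<close>. The weights satisfy \<open>\<omega> t \<ge> t\<close>, which makes \<open>S\<close> at least
  \<open>N (N + 1) / 2\<close>. If \<open>\<alpha> > 0\<close> they also dominate the geometric sequence with quotient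
  \<open>1 + 1 / sqrt (L / \<alpha>)\<close> that starts with \<open>1\<close> at \<open>t = 5\<close> (\<open>acgd_omega_ge_geometric\<close>).
\<close>

section \<open>Gradients, convexity and smoothness\<close>

lemma gderiv_gradient:
  fixes f :: "'a::euclidean_space \<Rightarrow> real"
  assumes "f differentiable (at x)"
  shows "GDERIV f x :> gradient f x"
proof -
  obtain f' where f': "(f has_derivative f') (at x)"
    using assms unfolding differentiable_def by blast
  then have "linear f'"
    by (rule has_derivative_linear)
  then have "f' h = inner h (adjoint f' 1)" for h
    using adjoint_works[of f' h 1] by simp
  then have "GDERIV f x :> adjoint f' 1"
    unfolding gderiv_def using f' by (metis (no_types, lifting) ext)
  then show ?thesis
    using gradient_eqI by metis
qed

lemma gradient_inner_jacobian:
  fixes g :: "real ^ 'n \<Rightarrow> real ^ 'm"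
  assumes "g differentiable (at x)"
  shows "inner h (gradient (\<lambda>z. g z $ i) x) = (jacobian g (at x) *v h) $ i"
proof -
  have der: "(g has_derivative (\<lambda>h. jacobian g (at x) *v h)) (at x)"
    using assms jacobian_works by blast
  then have comp: "((\<lambda>z. g z $ i) has_derivative (\<lambda>h. (jacobian g (at x) *v h) $ i)) (at x)"
    by (rule bounded_linear.has_derivative[OF bounded_linear_vec_nth])
  then have "GDERIV (\<lambda>z. g z $ i) x :> gradient (\<lambda>z. g z $ i) x"
    using gderiv_gradient differentiable_def by blast
  then show ?thesis
    unfolding gderiv_def using has_derivative_unique[OF comp] by metis
qed

lemma DERIV_along_line:
  assumes "GDERIV \<phi> (b + s *\<^sub>R w) :> d"
  shows "((\<lambda>s. \<phi> (b + s *\<^sub>R w)) has_real_derivative inner d w) (at s)"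
proof -
  have "((\<lambda>s. b + s *\<^sub>R w) has_derivative (\<lambda>h. h *\<^sub>R w)) (at s)"
    by (auto intro!: derivative_eq_intros)
  from has_derivative_compose[OF this assms[unfolded gderiv_def]]
  have "((\<lambda>s. \<phi> (b + s *\<^sub>R w)) has_derivative (\<lambda>h. inner (h *\<^sub>R w) d)) (at s)" .
  then show ?thesis
    unfolding has_field_derivative_def by (simp add: inner_commute mult_commute_abs)
qed

lemma convex_on_UNIV_tangent_le:
  fixes \<phi> :: "'a::real_inner \<Rightarrow> real"
  assumes "convex_on UNIV \<phi>" and "GDERIV \<phi> a :> d"
  shows "\<phi> a + inner d (z - a) \<le> \<phi> z"
proof -
  let ?h = "\<lambda>s::real. \<phi> (a + s *\<^sub>R (z - a))"
  have "convex_on UNIV ?h"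
  proof (rule convex_onI)
    fix t x y :: real
    assume t: "0 < t" "t < 1"
    have "a + ((1 - t) *\<^sub>R x + t *\<^sub>R y) *\<^sub>R (z - a)
        = (1 - t) *\<^sub>R (a + x *\<^sub>R (z - a)) + t *\<^sub>R (a + y *\<^sub>R (z - a))"
      by (simp add: algebra_simps)
    then show "?h ((1 - t) *\<^sub>R x + t *\<^sub>R y) \<le> (1 - t) * ?h x + t * ?h y"
      using convex_onD[OF assms(1), of t] t by simp
  qed simp
  moreover have "(?h has_real_derivative inner d (z - a)) (at 0)"
    using DERIV_along_line[of \<phi> a 0] assms(2) by simp
  ultimately have "?h 1 - ?h 0 \<ge> inner d (z - a) * (1 - 0)"
    by (intro convex_on_imp_above_tangent[of UNIV]) auto
  then show ?thesis
    by simp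
qed

text \<open>Along the segment from \<open>b\<close> to \<open>b + w\<close> the derivative of \<open>\<phi>\<close> exceeds its initial value
  by at most \<open>L s \<parallel>w\<parallel>\<^sup>2\<close>, which integrates to the quadratic term. Here the integration is the
  monotonicity of the difference of the two sides.\<close>

lemma lipschitz_gradient_upper_bound:
  fixes \<phi> :: "'a::real_inner \<Rightarrow> real"
  assumes der: "\<And>z. GDERIV \<phi> z :> p z" and lip: "L-lipschitz_on UNIV p"
  shows "\<phi> (b + w) \<le> \<phi> b + inner (p b) w + L / 2 * (norm w)\<^sup>2"
proof -
  let ?h = "\<lambda>s. \<phi> (b + s *\<^sub>R w) - s * inner (p b) w - L / 2 * s\<^sup>2 * (norm w)\<^sup>2"
  have "?h 1 \<le> ?h 0"
  proof (rule DERIV_nonpos_imp_nonincreasing[where f = ?h])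
    fix s :: real
    assume s: "0 \<le> s" "s \<le> 1"
    let ?d = "inner (p (b + s *\<^sub>R w)) w - inner (p b) w - L * s * (norm w)\<^sup>2"
    have "(?h has_real_derivative ?d) (at s)"
      by (auto intro!: derivative_eq_intros DERIV_along_line der)
    moreover have "?d \<le> 0"
    proof -
      have "inner (p (b + s *\<^sub>R w) - p b) w \<le> norm (p (b + s *\<^sub>R w) - p b) * norm w"
        by (rule norm_cauchy_schwarz)
      also have "\<dots> \<le> (L * norm (s *\<^sub>R w)) * norm w"
        using lipschitz_onD[OF lip, of "b + s *\<^sub>R w" b]
        by (intro mult_right_mono) (auto simp: dist_norm)
      finally show ?thesis
        using s by (simp add: inner_diff_left power2_eq_square mult.assoc)
    qed
    ultimately show "\<exists>d. (?h has_real_derivative d) (at s) \<and> d \<le> 0"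
      by blast
  qed simp
  then show ?thesis
    by simp
qed

text \<open>The Bregman distance of \<open>\<phi>\<close> from \<open>a\<close> to \<open>b\<close>, where \<open>p\<close> is the gradient map of \<open>\<phi>\<close>. By
  Fenchel duality it is also the Bregman distance of the conjugate function from \<open>p b\<close> to \<open>p a\<close>,
  the proximal term of the dual updates in the primal-dual reading of acceleration.\<close>

definition bregman ::
  "('a::real_inner \<Rightarrow> real) \<Rightarrow> ('a \<Rightarrow> 'a) \<Rightarrow> 'a \<Rightarrow> 'a \<Rightarrow> real" where
  "bregman \<phi> p b a = \<phi> b - \<phi> a - inner (p a) (b - a)"

text \<open>This plays the part of cocoercivity of the gradient followed by Young's inequality, but in one
  step and without division by \<open>L\<close>, so that \<open>L = 0\<close> is covered: at the point \<open>b + v / c\<close> the tangent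
  of \<open>\<phi>\<close> at \<open>a\<close> lies below the quadratic upper bound of \<open>\<phi>\<close> at \<open>b\<close>.\<close>

lemma inner_gradient_diff_le_bregman:
  fixes \<phi> :: "'a::real_inner \<Rightarrow> real"
  assumes tangent: "\<And>a z. \<phi> a + inner (p a) (z - a) \<le> \<phi> z"
    and upper: "\<And>b w. \<phi> (b + w) \<le> \<phi> b + inner (p b) w + L / 2 * (norm w)\<^sup>2"
    and c: "0 < c"
  shows "inner (p a - p b) v \<le> c * bregman \<phi> p b a + L / (2 * c) * (norm v)\<^sup>2"
proof -
  define w where "w = (1 / c) *\<^sub>R v"
  have v: "v = c *\<^sub>R w"
    using c by (simp add: w_def)
  have "\<phi> a + inner (p a) (b + w - a) \<le> \<phi> b + inner (p b) w + L / 2 * (norm w)\<^sup>2"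
    using tangent[of a "b + w"] upper[of b w] by linarith
  then have "inner (p a - p b) w \<le> bregman \<phi> p b a + L / 2 * (norm w)\<^sup>2"
    by (simp add: bregman_def inner_simps)
  then have "c * inner (p a - p b) w \<le> c * (bregman \<phi> p b a + L / 2 * (norm w)\<^sup>2)"
    using c by (intro mult_left_mono) auto
  moreover have "c * (L / 2 * (norm w)\<^sup>2) = L / (2 * c) * (norm v)\<^sup>2"
    using c by (simp add: v power_mult_distrib power2_eq_square field_simps)
  ultimately show ?thesis
    by (simp add: v distrib_left)
qed

section \<open>Quadratic growth from strong convexity\<close>

text \<open>Compare the minimum with the value at \<open>(1 - s) x + s z\<close>, divide by \<open>s\<close> and let \<open>s\<close> tend to \<open>0\<close>.
  The lemma serves twice: for the proximal subproblems, where it is the three-point inequality, and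
  for the Lagrangian at an optimal multiplier, where it bounds the distance to the solution.\<close>

lemma strongly_convex_on_minimizer_growth:
  fixes \<psi> :: "'a::real_inner \<Rightarrow> real"
  assumes sc: "strongly_convex_on D m \<psi>"
    and x: "x \<in> D" and min: "\<And>z. z \<in> D \<Longrightarrow> \<psi> x \<le> \<psi> z" and z: "z \<in> D"
  shows "\<psi> x + m / 2 * (norm (z - x))\<^sup>2 \<le> \<psi> z"
proof -
  let ?n = "(norm (x - z))\<^sup>2"
  have bound: "m / 2 * (1 - s) * ?n \<le> \<psi> z - \<psi> x" if s: "0 < s" "s < 1" for s :: real
  proof -
    have "(1 - s) *\<^sub>R x + s *\<^sub>R z \<in> D"
      using sc x z s convexD_alt[of D x z s] unfolding strongly_convex_on_def by simp
    from min[OF this]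
    have "\<psi> x \<le> (1 - s) * \<psi> x + s * \<psi> z - m / 2 * (s * (1 - s)) * ?n"
      by (rule order_trans) (use sc x z s in \<open>simp add: strongly_convex_on_def\<close>)
    then have "s * (m / 2 * (1 - s) * ?n) \<le> s * (\<psi> z - \<psi> x)"
      by (simp add: algebra_simps)
    then show ?thesis
      using s by simp
  qed
  have "((\<lambda>s. m / 2 * (1 - s) * ?n) \<longlongrightarrow> m / 2 * (1 - 0) * ?n) (at_right 0)"
    by (intro tendsto_intros)
  moreover have "\<forall>\<^sub>F s in at_right (0::real). m / 2 * (1 - s) * ?n \<le> \<psi> z - \<psi> x"
    using bound eventually_at_right_less[of "0::real"] by (auto simp: eventually_at_right_field intro!: exI[of _ 1])
  ultimately have "m / 2 * (1 - 0) * ?n \<le> \<psi> z - \<psi> x"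
    by (rule tendsto_upperbound) simp
  then show ?thesis
    by (simp add: norm_minus_commute)
qed

lemma strongly_convex_on_subset:
  "strongly_convex_on D m \<psi> \<Longrightarrow> S \<subseteq> D \<Longrightarrow> convex S \<Longrightarrow> strongly_convex_on S m \<psi>"
  unfolding strongly_convex_on_def by blast

lemma strongly_convex_on_add_affine:
  assumes "strongly_convex_on D m \<psi>"
  shows "strongly_convex_on D m (\<lambda>z. inner v z + c + \<psi> z)"
  unfolding strongly_convex_on_def
proof (intro conjI ballI)
  show "convex D"
    using assms by (simp add: strongly_convex_on_def)
  fix x y and s :: real
  assume "x \<in> D" "y \<in> D" "s \<in> {0..1}"
  then have "\<psi> ((1 - s) *\<^sub>R x + s *\<^sub>R y)
      \<le> (1 - s) * \<psi> x + s * \<psi> y - m / 2 * (s * (1 - s)) * (norm (x - y))\<^sup>2"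
    using assms unfolding strongly_convex_on_def by blast
  then show "inner v ((1 - s) *\<^sub>R x + s *\<^sub>R y) + c + \<psi> ((1 - s) *\<^sub>R x + s *\<^sub>R y)
      \<le> (1 - s) * (inner v x + c + \<psi> x) + s * (inner v y + c + \<psi> y)
        - m / 2 * (s * (1 - s)) * (norm (x - y))\<^sup>2"
    by (simp add: inner_simps algebra_simps)
qed

text \<open>The squared norm satisfies the defining inequality of strong convexity with equality.\<close>

lemma strongly_convex_on_add_quadratic:
  assumes "strongly_convex_on D m \<psi>"
  shows "strongly_convex_on D (\<eta> + m) (\<lambda>z. \<psi> z + \<eta> / 2 * (norm (z - q))\<^sup>2)"
  unfolding strongly_convex_on_def
proof (intro conjI ballI)
  show "convex D"
    using assms by (simp add: strongly_convex_on_def)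
  fix x y and s :: real
  assume "x \<in> D" "y \<in> D" "s \<in> {0..1}"
  then have "\<psi> ((1 - s) *\<^sub>R x + s *\<^sub>R y)
      \<le> (1 - s) * \<psi> x + s * \<psi> y - m / 2 * (s * (1 - s)) * (norm (x - y))\<^sup>2"
    using assms unfolding strongly_convex_on_def by blast
  moreover have "(norm ((1 - s) *\<^sub>R x + s *\<^sub>R y - q))\<^sup>2
      = (1 - s) * (norm (x - q))\<^sup>2 + s * (norm (y - q))\<^sup>2 - s * (1 - s) * (norm (x - y))\<^sup>2"
    unfolding power2_norm_eq_inner by (simp add: inner_simps inner_commute algebra_simps)
  ultimately have "\<psi> ((1 - s) *\<^sub>R x + s *\<^sub>R y) + \<eta> / 2 * (norm ((1 - s) *\<^sub>R x + s *\<^sub>R y - q))\<^sup>2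
      \<le> ((1 - s) * \<psi> x + s * \<psi> y - m / 2 * (s * (1 - s)) * (norm (x - y))\<^sup>2) + \<eta> / 2 *
        ((1 - s) * (norm (x - q))\<^sup>2 + s * (norm (y - q))\<^sup>2 - s * (1 - s) * (norm (x - y))\<^sup>2)"
    by simp
  then show "\<psi> ((1 - s) *\<^sub>R x + s *\<^sub>R y) + \<eta> / 2 * (norm ((1 - s) *\<^sub>R x + s *\<^sub>R y - q))\<^sup>2
      \<le> (1 - s) * (\<psi> x + \<eta> / 2 * (norm (x - q))\<^sup>2) + s * (\<psi> y + \<eta> / 2 * (norm (y - q))\<^sup>2)
        - (\<eta> + m) / 2 * (s * (1 - s)) * (norm (x - y))\<^sup>2"
    by (simp add: field_simps)
qed

section \<open>The accelerated recursion\<close>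

text \<open>What it costs to replace the tangent of \<open>\<phi>\<close> at \<open>y'\<close>, which the method sees, by the tangent at
  an arbitrary reference point \<open>a\<close>. As \<open>y'\<close> is an average of \<open>y\<close> and the extrapolated point, the
  three-point identity for Bregman distances turns the difference into terms that telescope, up to
  the gradient differences that the two last summands carry.\<close>

lemma linearization_gap_identity:
  fixes \<phi> :: "'a::real_inner \<Rightarrow> real"
  assumes y': "(1 + \<tau>) *\<^sub>R y' = \<tau> *\<^sub>R y + (x1 + \<theta> *\<^sub>R (x1 - x0))"
  shows "\<phi> a + inner (p a) (x2 - a) - (\<phi> y' + inner (p y') (x2 - y'))
    = \<tau> * bregman \<phi> p y a - (1 + \<tau>) * bregman \<phi> p y' a - \<tau> * bregman \<phi> p y y'
      + inner (p a - p y') (x2 - x1) - \<theta> * inner (p a - p y') (x1 - x0)"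
proof -
  have "x1 = (1 + \<tau>) *\<^sub>R y' - \<tau> *\<^sub>R y - \<theta> *\<^sub>R (x1 - x0)"
    using y' by (simp add: algebra_simps)
  then have "inner w x1 = (1 + \<tau>) * inner w y' - \<tau> * inner w y - \<theta> * inner w (x1 - x0)" for w
    by (metis inner_diff_right inner_scaleR_right)
  from this[of "p a"] this[of "p y'"] show ?thesis
    by (simp add: bregman_def inner_simps algebra_simps)
qed

text \<open>The potential \<open>V\<close> collects what the \<open>n\<close>-th step leaves behind. In the weighted sum of the
  one-step inequalities the distances to \<open>a\<close> telescope because of \<open>\<omega>\<tau>\<close>, the inner products with
  \<open>p a\<close> because of \<open>\<omega>\<theta>\<close>, and the distances to \<open>z\<close> because of \<open>\<omega>\<eta>\<close>. The remaining
  \<open>p (y (Suc n)) - p (y n)\<close> is tested against the previous displacement of \<open>x\<close> and is absorbed by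
  a Bregman distance and the proximal term of the previous step; that is the condition \<open>\<eta>\<close>.
  The reference point \<open>a\<close> is free, so it can later be the average of the \<open>x t\<close>, which depends on
  all of them.\<close>

lemma accelerated_gap:
  fixes \<phi> :: "'a::real_inner \<Rightarrow> real" and x y :: "nat \<Rightarrow> 'a"
  assumes tangent: "\<And>a z. \<phi> a + inner (p a) (z - a) \<le> \<phi> z"
    and upper: "\<And>b w. \<phi> (b + w) \<le> \<phi> b + inner (p b) w + L / 2 * (norm w)\<^sup>2"
    and y: "\<And>t. t \<in> {1..N} \<Longrightarrow>
      (1 + \<tau> t) *\<^sub>R y t = \<tau> t *\<^sub>R y (t - 1) + (x (t - 1) + \<theta> t *\<^sub>R (x (t - 1) - x (t - 2)))"
    and prox: "\<And>t. t \<in> {1..N} \<Longrightarrow>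
      \<phi> (y t) + inner (p (y t)) (x t - y t) + G t + \<eta> t / 2 * (norm (x t - x (t - 1)))\<^sup>2
        + (\<eta> t + \<alpha>) / 2 * (norm (z - x t))\<^sup>2 \<le> \<eta> t / 2 * (norm (z - x (t - 1)))\<^sup>2"
    and start: "\<tau> 1 = 0" "\<theta> 1 = 0"
    and \<tau>: "\<And>t. 1 \<le> t \<Longrightarrow> 0 \<le> \<tau> t"
    and \<omega>: "\<And>t. 1 \<le> t \<Longrightarrow> 0 < \<omega> t"
    and \<omega>\<tau>: "\<And>t. 1 \<le> t \<Longrightarrow> \<omega> (Suc t) * \<tau> (Suc t) = \<omega> t * (1 + \<tau> t)"
    and \<omega>\<theta>: "\<And>t. 1 \<le> t \<Longrightarrow> \<omega> (Suc t) * \<theta> (Suc t) = \<omega> t"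
    and \<omega>\<eta>: "\<And>t. 1 \<le> t \<Longrightarrow> \<omega> (Suc t) * \<eta> (Suc t) \<le> \<omega> t * (\<eta> t + \<alpha>)"
    and \<eta>: "\<And>t. 1 \<le> t \<Longrightarrow> L / (1 + \<tau> t) \<le> \<eta> t"
    and N: "1 \<le> N"
  shows "(\<Sum>t=1..N. \<omega> t * (\<phi> a + inner (p a) (x t - a) + G t))
      + \<omega> N * (\<eta> N + \<alpha>) / 2 * (norm (z - x N))\<^sup>2 \<le> \<omega> 1 * \<eta> 1 / 2 * (norm (z - x 0))\<^sup>2"
proof -
  define B where "B = bregman \<phi> p"
  define E where "E t = (norm (x t - x (t - 1)))\<^sup>2" for t
  define R where "R t = (norm (z - x t))\<^sup>2" for t
  define I where "I b t = inner (p b - p (y t)) (x t - x (t - 1))" for b t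
  define V where "V t = (1 + \<tau> t) * B (y t) a - I a t + \<eta> t / 2 * E t + (\<eta> t + \<alpha>) / 2 * R t" for t
  have young: "I b t \<le> (1 + \<tau> t) * B (y t) b + \<eta> t / 2 * E t" if t: "1 \<le> t" for b t
  proof -
    have "I b t \<le> (1 + \<tau> t) * B (y t) b + L / (2 * (1 + \<tau> t)) * E t"
      unfolding I_def B_def E_def using \<tau>[OF t]
      by (intro inner_gradient_diff_le_bregman tangent upper) auto
    also have "L / (2 * (1 + \<tau> t)) = L / (1 + \<tau> t) / 2"
      by (metis divide_divide_eq_left mult.commute)
    also have "L / (1 + \<tau> t) / 2 * E t \<le> \<eta> t / 2 * E t"
      by (intro mult_right_mono divide_right_mono \<eta> t) (auto simp: E_def)
    finally show ?thesis
      by simp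
  qed
  have one_step: "\<phi> a + inner (p a) (x t - a) + G t + V t
      \<le> \<eta> t / 2 * R (t - 1) + \<tau> t * (B (y (t - 1)) a - B (y (t - 1)) (y t))
        - \<theta> t * inner (p a - p (y t)) (x (t - 1) - x (t - 2))" if t: "t \<in> {1..N}" for t
    using prox[OF t] linearization_gap_identity[OF y[OF t], where \<phi> = \<phi> and p = p and a = a and ?x2.0 = "x t"]
    unfolding V_def B_def E_def R_def I_def right_diff_distrib[of "\<tau> t"] by linarith
  have "(\<Sum>t=1..n. \<omega> t * (\<phi> a + inner (p a) (x t - a) + G t)) + \<omega> n * V n
      \<le> \<omega> 1 * \<eta> 1 / 2 * R 0" if "1 \<le> n" "n \<le> N" for n
    using that
  proof (induction n rule: nat_induct_at_least)
    case base
    have "\<phi> a + inner (p a) (x 1 - a) + G 1 + V 1 \<le> \<eta> 1 / 2 * R 0"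
      using one_step[of 1] base start by simp
    from mult_left_mono[OF this, of "\<omega> 1"] show ?case
      using \<omega>[of 1] by (simp add: algebra_simps)
  next
    case (Suc n)
    let ?D = "\<phi> a + inner (p a) (x (Suc n) - a) + G (Suc n)"
    have "\<omega> (Suc n) * (?D + V (Suc n))
        \<le> \<omega> (Suc n) * (\<eta> (Suc n) / 2 * R n + \<tau> (Suc n) * (B (y n) a - B (y n) (y (Suc n)))
            - \<theta> (Suc n) * inner (p a - p (y (Suc n))) (x n - x (n - 1)))"
      using one_step[of "Suc n"] Suc.prems \<omega>[of "Suc n"] by (intro mult_left_mono) auto
    also have "\<dots> = \<omega> (Suc n) * \<eta> (Suc n) / 2 * R n
        + \<omega> (Suc n) * \<tau> (Suc n) * (B (y n) a - B (y n) (y (Suc n)))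
        - \<omega> (Suc n) * \<theta> (Suc n) * (I a n - I (y (Suc n)) n)"
      by (simp add: I_def inner_diff_left algebra_simps)
    also have "\<dots> = \<omega> (Suc n) * \<eta> (Suc n) / 2 * R n
        + \<omega> n * ((1 + \<tau> n) * B (y n) a - I a n + (I (y (Suc n)) n - (1 + \<tau> n) * B (y n) (y (Suc n))))"
      using \<omega>\<tau>[OF Suc.hyps] \<omega>\<theta>[OF Suc.hyps] by (simp add: algebra_simps)
    also have "\<dots> \<le> \<omega> n * (\<eta> n + \<alpha>) / 2 * R n
        + \<omega> n * ((1 + \<tau> n) * B (y n) a - I a n + \<eta> n / 2 * E n)"
    proof (rule add_mono)
      show "\<omega> (Suc n) * \<eta> (Suc n) / 2 * R n \<le> \<omega> n * (\<eta> n + \<alpha>) / 2 * R n"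
        using \<omega>\<eta>[OF Suc.hyps] by (intro mult_right_mono divide_right_mono) (auto simp: R_def)
    qed (use young[OF Suc.hyps, of "y (Suc n)"] \<omega>[OF Suc.hyps] in \<open>intro mult_left_mono, auto\<close>)
    also have "\<dots> = \<omega> n * V n"
      by (simp add: V_def algebra_simps)
    finally show ?case
      using Suc by (simp add: algebra_simps)
  qed
  from this[OF N order_refl]
  have "(\<Sum>t=1..N. \<omega> t * (\<phi> a + inner (p a) (x t - a) + G t)) + \<omega> N * V N \<le> \<omega> 1 * \<eta> 1 / 2 * R 0" .
  moreover have "\<omega> N * ((\<eta> N + \<alpha>) / 2 * R N) \<le> \<omega> N * V N"
    using young[OF N, of a] \<omega>[OF N] by (intro mult_left_mono) (auto simp: V_def)
  ultimately show ?thesis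
    by (simp add: R_def)
qed

section \<open>The step sizes\<close>

lemma sqrt_condition_number:
  fixes L \<alpha> :: real
  assumes "0 < \<alpha>" "\<alpha> \<le> L"
  shows "1 \<le> sqrt (L / \<alpha>)" "L = \<alpha> * (sqrt (L / \<alpha>))\<^sup>2"
  using assms by (auto simp: divide_simps)

lemma acgd_tau_nonneg: "0 \<le> L \<Longrightarrow> 0 \<le> \<alpha> \<Longrightarrow> 1 \<le> t \<Longrightarrow> 0 \<le> acgd_tau L \<alpha> t"
  by (simp add: acgd_tau_def)

lemma acgd_tau_pos: "0 \<le> \<alpha> \<Longrightarrow> \<alpha> \<le> L \<Longrightarrow> 2 \<le> t \<Longrightarrow> 0 < acgd_tau L \<alpha> t"
  by (simp add: acgd_tau_def)

lemma acgd_tau_Suc_le: "acgd_tau L \<alpha> (Suc t) \<le> 1 + acgd_tau L \<alpha> t"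
  by (auto simp: acgd_tau_def min_def field_simps)

lemma acgd_omega_Suc:
  assumes "1 \<le> t"
  shows "acgd_omega L \<alpha> (Suc t)
    = acgd_omega L \<alpha> t * ((1 + acgd_tau L \<alpha> t) / acgd_tau L \<alpha> (Suc t))"
  using assms by (cases t) (simp_all add: acgd_theta_def add.commute)

lemma acgd_omega_pos:
  assumes "0 \<le> \<alpha>" "\<alpha> \<le> L" "1 \<le> t"
  shows "0 < acgd_omega L \<alpha> t"
  using \<open>1 \<le> t\<close>
proof (induction t rule: nat_induct_at_least)
  case (Suc t)
  then show ?case
    using acgd_tau_pos[OF assms(1,2), of "Suc t"] acgd_tau_nonneg[of L \<alpha> t] assms
    by (simp add: acgd_omega_Suc)
qed simp

lemma acgd_eta_ge:
  assumes "0 \<le> \<alpha>" "\<alpha> \<le> L" "1 \<le> t"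
  shows "L / (1 + acgd_tau L \<alpha> t) \<le> acgd_eta L \<alpha> t"
  using acgd_tau_Suc_le[of L \<alpha> t] acgd_tau_pos[of \<alpha> L "Suc t"] assms
  by (simp add: acgd_eta_def divide_left_mono)

text \<open>The condition \<open>acgd_omega_eta\<close> with its denominators cleared. While \<open>\<tau>\<close> still grows linearly
  the new value is exactly \<open>1 + \<tau> t\<close>, and once it is constant equal to \<open>s = sqrt (L / \<alpha>)\<close> the strong
  convexity term \<open>\<alpha> s\<close> makes up for the missing growth, since \<open>\<alpha> s\<^sup>2 = L\<close>. The delicate case is the
  switch between the two regimes, where \<open>s\<close> lies between the last linear value \<open>t / 2\<close> and
  \<open>t / 2 + 1 / 2\<close>.\<close>

lemma acgd_tau_transition:
  assumes "0 \<le> \<alpha>" "\<alpha> \<le> L" "1 \<le> t"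
  shows "L * (1 + acgd_tau L \<alpha> t)
    \<le> acgd_tau L \<alpha> (Suc (Suc t)) * (L + \<alpha> * acgd_tau L \<alpha> (Suc t))"
proof (cases "\<alpha> = 0")
  case True
  then show ?thesis
    by (simp add: acgd_tau_def field_simps)
next
  case False
  define s where "s = sqrt (L / \<alpha>)"
  have s: "1 \<le> s" "L = \<alpha> * s\<^sup>2"
    using sqrt_condition_number[of \<alpha> L] False assms by (auto simp: s_def)
  have \<tau>: "acgd_tau L \<alpha> k = min ((real k - 1) / 2) s" for k
    using False by (simp add: acgd_tau_def s_def)
  let ?a = "acgd_tau L \<alpha> t" and ?b = "acgd_tau L \<alpha> (Suc t)" and ?c = "acgd_tau L \<alpha> (Suc (Suc t))"
  have "s\<^sup>2 * (1 + ?a) \<le> ?c * (s\<^sup>2 + ?b)"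
  proof -
    consider "real t / 2 + 1 / 2 \<le> s" | "real t / 2 \<le> s" "s < real t / 2 + 1 / 2" | "s < real t / 2"
      by linarith
    then show ?thesis
    proof cases
      case 1
      then have "?c = 1 + ?a" "0 \<le> ?b" "0 \<le> ?c"
        using \<tau> by (auto simp: min_def field_simps)
      then have "?c * s\<^sup>2 \<le> ?c * (s\<^sup>2 + ?b)"
        by (intro mult_left_mono) auto
      then show ?thesis
        using \<open>?c = 1 + ?a\<close> by (simp add: mult.commute)
    next
      case 2
      then have e: "?c = s" "?b = real t / 2" "?a = real t / 2 - 1 / 2"
        using \<tau> by (auto simp: min_def field_simps)
      have "s * (s * (1 + ?a)) \<le> s * (s * s + ?b)"
      proof (rule mult_left_mono)
        have "s * (real t / 2 + 1 / 2 - s) \<le> s * (1 / 2)"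
          using 2 s by (intro mult_left_mono) auto
        moreover have "s * (1 + ?a) = s * s + s * (real t / 2 + 1 / 2 - s)"
          unfolding e by (simp add: algebra_simps)
        ultimately show "s * (1 + ?a) \<le> s * s + ?b"
          using 2 e assms(3) by linarith
      qed (use s in auto)
      then show ?thesis
        by (simp only: e(1) power2_eq_square mult.assoc)
    next
      case 3
      then have "?c = s" "?b = s" "?a \<le> s"
        using \<tau> by (auto simp: min_def field_simps)
      then show ?thesis
        using s mult_left_mono[of ?a s "s\<^sup>2"] by (simp add: algebra_simps power2_eq_square)
    qed
  qed
  then have "\<alpha> * (s\<^sup>2 * (1 + ?a)) \<le> \<alpha> * (?c * (s\<^sup>2 + ?b))"
    using assms by (intro mult_left_mono) auto
  then show ?thesis
    unfolding s(2) by (simp add: algebra_simps)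
qed

lemma acgd_omega_tau:
  assumes "0 \<le> \<alpha>" "\<alpha> \<le> L" "1 \<le> t"
  shows "acgd_omega L \<alpha> (Suc t) * acgd_tau L \<alpha> (Suc t) = acgd_omega L \<alpha> t * (1 + acgd_tau L \<alpha> t)"
  using acgd_tau_pos[of \<alpha> L "Suc t"] assms by (simp add: acgd_omega_Suc)

lemma acgd_omega_theta:
  assumes "0 \<le> \<alpha>" "\<alpha> \<le> L" "1 \<le> t"
  shows "acgd_omega L \<alpha> (Suc t) * acgd_theta L \<alpha> (Suc t) = acgd_omega L \<alpha> t"
  using acgd_tau_pos[of \<alpha> L "Suc t"] acgd_tau_nonneg[of L \<alpha> t] assms
  by (simp add: acgd_omega_Suc acgd_theta_def add.commute[of "acgd_tau L \<alpha> t" 1])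

lemma acgd_omega_eta:
  assumes "0 \<le> \<alpha>" "\<alpha> \<le> L" "1 \<le> t"
  shows "acgd_omega L \<alpha> (Suc t) * acgd_eta L \<alpha> (Suc t) \<le> acgd_omega L \<alpha> t * (acgd_eta L \<alpha> t + \<alpha>)"
proof -
  let ?a = "acgd_tau L \<alpha> t" and ?b = "acgd_tau L \<alpha> (Suc t)" and ?c = "acgd_tau L \<alpha> (Suc (Suc t))"
  have pos: "0 < ?b" "0 < ?c"
    using acgd_tau_pos[of \<alpha> L] assms by auto
  have "(1 + ?a) / ?b * (L / ?c) = L * (1 + ?a) / (?b * ?c)"
    by simp
  also have "\<dots> \<le> ?c * (L + \<alpha> * ?b) / (?b * ?c)"
    using acgd_tau_transition[OF assms] pos by (intro divide_right_mono) auto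
  also have "\<dots> = L / ?b + \<alpha>"
    using pos by (simp add: field_simps)
  finally have "acgd_omega L \<alpha> t * ((1 + ?a) / ?b * (L / ?c)) \<le> acgd_omega L \<alpha> t * (L / ?b + \<alpha>)"
    using acgd_omega_pos[OF assms] by (intro mult_left_mono) auto
  then show ?thesis
    using assms by (simp add: acgd_omega_Suc acgd_eta_def mult.assoc)
qed

text \<open>While \<open>\<tau> (Suc t) = t / 2\<close> the quotient of consecutive weights is exactly \<open>(t + 1) / t\<close>; capping
  \<open>\<tau>\<close> can only increase it.\<close>

lemma acgd_omega_ge:
  assumes "0 \<le> \<alpha>" "\<alpha> \<le> L" "1 \<le> t"
  shows "real t \<le> acgd_omega L \<alpha> t"
  using \<open>1 \<le> t\<close>
proof (induction t rule: nat_induct_at_least)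
  case (Suc t)
  let ?a = "acgd_tau L \<alpha> t" and ?b = "acgd_tau L \<alpha> (Suc t)"
  have b: "0 < ?b" "?b \<le> real t / 2"
    using acgd_tau_pos[of \<alpha> L "Suc t"] assms Suc.hyps by (auto simp: acgd_tau_def)
  have ab: "?b \<le> ?a \<or> ?a = (real t - 1) / 2"
    by (auto simp: acgd_tau_def min_def field_simps)
  have "real (Suc t) * ?b \<le> real t * (1 + ?a)"
    using ab
  proof
    assume "?b \<le> ?a"
    then have "real t * ?b \<le> real t * ?a"
      by (intro mult_left_mono) auto
    with b show ?thesis
      unfolding of_nat_Suc distrib_left distrib_right by linarith
  next
    assume a: "?a = (real t - 1) / 2"
    have "real (Suc t) * ?b \<le> real (Suc t) * (real t / 2)"
      using b by (intro mult_left_mono) auto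
    also have "\<dots> = real t * (1 + ?a)"
      unfolding a by (simp add: field_simps)
    finally show ?thesis .
  qed
  then have "real (Suc t) \<le> real t * ((1 + ?a) / ?b)"
    using b by (simp add: pos_le_divide_eq)
  also have "\<dots> \<le> acgd_omega L \<alpha> t * ((1 + ?a) / ?b)"
    using Suc b acgd_tau_nonneg[of L \<alpha> t] assms by (intro mult_right_mono) auto
  finally show ?case
    using Suc.hyps by (simp add: acgd_omega_Suc)
qed simp

text \<open>For \<open>2 s \<ge> k + 3\<close> the left-hand side is below \<open>exp 2 < 9\<close> for every \<open>k\<close>, which settles large \<open>k\<close>;
  for small \<open>k\<close> the bound \<open>exp w \<le> 1 / (1 - w)\<close> is sharp enough.\<close>

lemma one_plus_inverse_power_le:
  fixes s :: real
  assumes "real k + 3 \<le> 2 * s"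
  shows "(1 + 1 / s) ^ k \<le> real k + 5"
proof -
  \<comment> \<open>Half the exponent in the worst case \<open>2 s = k + 3\<close>.\<close>
  define w where "w = real k / (real k + 3)"
  have w: "0 \<le> w" "w < 1"
    by (auto simp: w_def)
  have "(1 + 1 / s) ^ k \<le> exp (1 / s) ^ k"
    using assms by (intro power_mono exp_ge_add_one_self) auto
  also have "\<dots> = exp (real k / s)"
    by (simp flip: exp_of_nat_mult)
  also have "\<dots> \<le> exp (2 * w)"
  proof -
    have "real k / s \<le> real k / ((real k + 3) / 2)"
      using assms by (intro divide_left_mono) auto
    then show ?thesis
      by (simp add: w_def mult.commute)
  qed
  also have "\<dots> = (exp w)\<^sup>2"
    by (simp add: exp_double)
  also have "\<dots> \<le> real k + 5"
  proof (cases "k \<le> 7")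
    case True
    have "1 - w \<le> exp (- w)"
      using exp_ge_add_one_self[of "- w"] by simp
    then have "exp w \<le> 1 / (1 - w)"
      using w by (simp add: exp_minus field_simps)
    also have "1 / (1 - w) = (real k + 3) / 3"
      by (simp add: w_def field_simps)
    finally have "(exp w)\<^sup>2 \<le> ((real k + 3) / 3)\<^sup>2"
      by (intro power_mono) auto
    also have "\<dots> \<le> real k + 5"
    proof -
      have "k * k \<le> 7 * k"
        using True by simp
      then have "real k * real k \<le> 7 * real k"
        by (metis of_nat_le_iff of_nat_mult of_nat_numeral)
      then show ?thesis
        using True by (simp add: power2_eq_square field_simps)
    qed
    finally show ?thesis .
  next
    case False
    have "exp w \<le> 3"
      using w exp_le by (meson exp_le_cancel_iff less_imp_le order_trans)
    then have "(exp w)\<^sup>2 \<le> 3\<^sup>2"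
      by (intro power_mono) auto
    then show ?thesis
      using False by simp
  qed
  finally show ?thesis .
qed

text \<open>Once \<open>\<tau>\<close> has reached \<open>sqrt (L / \<alpha>)\<close> twice in a row, each weight is \<open>1 + 1 / sqrt (L / \<alpha>)\<close> times
  the previous one. In the linear phase, and at the switch, the quotient can be smaller; there the
  weight is at least \<open>t\<close>, which still beats the geometric sequence because that one starts only
  at \<open>t = 5\<close>. This late start is where the exponent \<open>N - 4\<close> in the linear rate comes from.\<close>

lemma acgd_omega_ge_geometric:
  assumes "0 < \<alpha>" "\<alpha> \<le> L" "5 \<le> t"
  shows "(1 + 1 / sqrt (L / \<alpha>)) ^ (t - 5) \<le> acgd_omega L \<alpha> t"
  using \<open>5 \<le> t\<close>
proof (induction t rule: nat_induct_at_least)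
  case base
  then show ?case
    using acgd_omega_ge[of \<alpha> L 5] assms by simp
next
  case (Suc t)
  define s where "s = sqrt (L / \<alpha>)"
  have s: "1 \<le> s"
    using sqrt_condition_number[of \<alpha> L] assms by (auto simp: s_def)
  show ?case
  proof (cases "real t - 1 \<le> 2 * s")
    case True
    then have "(1 + 1 / s) ^ (t - 4) \<le> real (t - 4) + 5"
      using Suc.hyps by (intro one_plus_inverse_power_le) (auto simp: of_nat_diff)
    also have "\<dots> = real (Suc t)"
      using Suc.hyps by (simp add: of_nat_diff)
    also have "\<dots> \<le> acgd_omega L \<alpha> (Suc t)"
      using acgd_omega_ge[of \<alpha> L "Suc t"] assms by simp
    finally show ?thesis
      by (simp add: s_def)
  next
    case False
    then have "acgd_tau L \<alpha> t = s" "acgd_tau L \<alpha> (Suc t) = s"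
      using assms by (auto simp: acgd_tau_def s_def min_def)
    then have "acgd_omega L \<alpha> (Suc t) = acgd_omega L \<alpha> t * (1 + 1 / s)"
      using acgd_omega_Suc[of t L \<alpha>] Suc.hyps s by (simp add: field_simps)
    moreover have "(1 + 1 / s) ^ (Suc t - 5) = (1 + 1 / s) ^ (t - 5) * (1 + 1 / s)"
      unfolding Suc_diff_le[OF Suc.hyps] by (rule power_Suc2)
    ultimately show ?thesis
      using Suc.IH s by (simp add: s_def mult_right_mono del: power_Suc)
  qed
qed

lemma sum_acgd_omega_ge:
  assumes "0 \<le> \<alpha>" "\<alpha> \<le> L"
  shows "real N * (real N + 1) / 2 \<le> (\<Sum>t=1..N. acgd_omega L \<alpha> t)"
proof (induction N)
  case (Suc N)
  then show ?case
    using acgd_omega_ge[OF assms, of "Suc N"] by (simp add: field_simps)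
qed simp

text \<open>With \<open>s = sqrt (L / \<alpha>)\<close> and \<open>q = 1 + 1 / s\<close>, the left-hand side is the geometric sum
  \<open>1 + q + \<dots> + q ^ (N - 5)\<close>.\<close>

lemma sum_acgd_omega_ge_geometric:
  fixes L \<alpha> :: real
  defines "s \<equiv> sqrt (L / \<alpha>)"
  assumes "0 < \<alpha>" "\<alpha> \<le> L" "4 \<le> N"
  shows "s * ((1 + 1 / s) ^ (N - 4) - 1) \<le> (\<Sum>t=1..N. acgd_omega L \<alpha> t)"
  using \<open>4 \<le> N\<close>
proof (induction N rule: nat_induct_at_least)
  case base
  then show ?case
    using sum_acgd_omega_ge[of \<alpha> L 4] assms(2,3) by simp
next
  case (Suc N)
  have s: "1 \<le> s"
    using sqrt_condition_number[of \<alpha> L] assms by (auto simp: s_def)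
  have "s * ((1 + 1 / s) ^ (Suc N - 4) - 1) = s * ((1 + 1 / s) ^ (N - 4) - 1) + (1 + 1 / s) ^ (N - 4)"
    unfolding Suc_diff_le[OF Suc.hyps] power_Suc
    using s by (simp add: distrib_right right_diff_distrib distrib_left)
  moreover have "(1 + 1 / s) ^ (N - 4) \<le> acgd_omega L \<alpha> (Suc N)"
    using acgd_omega_ge_geometric[of \<alpha> L "Suc N"] assms Suc.hyps by (simp add: s_def)
  ultimately show ?case
    using Suc.IH Suc.hyps by simp
qed


section \<open>Ergodic averages\<close>

lemma ergodic_average_in_convex:
  assumes "convex X" and "\<And>t. t \<in> {1..N} \<Longrightarrow> 0 < \<omega> t" and "\<And>t. t \<in> {1..N} \<Longrightarrow> x t \<in> X" and "1 \<le> N"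
  shows "ergodic_average \<omega> x N \<in> X"
proof -
  let ?S = "\<Sum>t=1..N. \<omega> t"
  have S: "0 < ?S"
    using assms by (intro sum_pos) auto
  have "(\<Sum>t=1..N. (\<omega> t / ?S) *\<^sub>R x t) \<in> X"
    using assms S by (intro convex_sum) (auto simp: less_imp_le simp flip: sum_divide_distrib)
  then show ?thesis
    by (simp add: ergodic_average_def scaleR_sum_right divide_inverse mult.commute)
qed

lemma convex_on_ergodic_average_le:
  assumes "convex_on X u" and "\<And>t. t \<in> {1..N} \<Longrightarrow> 0 < \<omega> t" and "\<And>t. t \<in> {1..N} \<Longrightarrow> x t \<in> X" and "1 \<le> N"
  shows "(\<Sum>t=1..N. \<omega> t) * u (ergodic_average \<omega> x N) \<le> (\<Sum>t=1..N. \<omega> t * u (x t))"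
proof -
  let ?S = "\<Sum>t=1..N. \<omega> t"
  have S: "0 < ?S"
    using assms by (intro sum_pos) auto
  have "u (\<Sum>t=1..N. (\<omega> t / ?S) *\<^sub>R x t) \<le> (\<Sum>t=1..N. \<omega> t / ?S * u (x t))"
    using assms S by (intro convex_on_sum) (auto simp: less_imp_le simp flip: sum_divide_distrib)
  also have "(\<Sum>t=1..N. (\<omega> t / ?S) *\<^sub>R x t) = ergodic_average \<omega> x N"
    by (simp add: ergodic_average_def scaleR_sum_right divide_inverse mult.commute)
  also have "(\<Sum>t=1..N. \<omega> t / ?S * u (x t)) = (\<Sum>t=1..N. \<omega> t * u (x t)) / ?S"
    by (simp add: sum_divide_distrib)
  finally show ?thesis
    using S by (simp add: pos_le_divide_eq mult.commute)
qed

lemma sum_inner_ergodic_average_eq_0: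
  assumes "(\<Sum>t=1..N. \<omega> t) \<noteq> 0"
  shows "(\<Sum>t=1..N. \<omega> t * inner v (x t - ergodic_average \<omega> x N)) = 0"
proof -
  have "(\<Sum>t=1..N. \<omega> t *\<^sub>R x t) = (\<Sum>t=1..N. \<omega> t) *\<^sub>R ergodic_average \<omega> x N"
    using assms by (simp add: ergodic_average_def)
  then have "(\<Sum>t=1..N. \<omega> t *\<^sub>R (x t - ergodic_average \<omega> x N)) = 0"
    by (simp add: scaleR_diff_right sum_subtractf scaleR_sum_left)
  then have "inner v (\<Sum>t=1..N. \<omega> t *\<^sub>R (x t - ergodic_average \<omega> x N)) = 0"
    by simp
  then show ?thesis
    by (simp add: inner_sum_right)
qed

section \<open>The Lagrangian\<close>

definition lagrangian_gradient ::
  "(real ^ 'n \<Rightarrow> real) \<Rightarrow> (real ^ 'n \<Rightarrow> real ^ 'm) \<Rightarrow> real ^ 'm \<Rightarrow> real ^ 'n \<Rightarrow> real ^ 'n" where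
  "lagrangian_gradient f g l z = gradient f z + (\<Sum>i\<in>UNIV. l $ i *\<^sub>R gradient (\<lambda>w. g w $ i) z)"

lemma inner_lagrangian_gradient:
  assumes "g differentiable (at z)"
  shows "inner (lagrangian_gradient f g l z) h = inner (gradient f z) h + inner l (jacobian g (at z) *v h)"
proof -
  have "inner (gradient (\<lambda>w. g w $ i) z) h = (jacobian g (at z) *v h) $ i" for i
    using gradient_inner_jacobian[OF assms] by (simp add: inner_commute)
  then show ?thesis
    unfolding lagrangian_gradient_def inner_vec_def[of l]
    by (simp add: inner_add_left inner_sum_left)
qed

lemma gderiv_lagrangian:
  assumes "f differentiable (at z)" and "g differentiable (at z)"
  shows "GDERIV (\<lambda>w. f w + inner l (g w)) z :> lagrangian_gradient f g l z"
proof -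
  have "(f has_derivative (\<lambda>h. inner h (gradient f z))) (at z)"
    using gderiv_gradient[OF assms(1)] by (simp add: gderiv_def)
  moreover have "(g has_derivative (\<lambda>h. jacobian g (at z) *v h)) (at z)"
    using assms(2) jacobian_works by blast
  ultimately have "((\<lambda>w. f w + inner l (g w)) has_derivative
      (\<lambda>h. inner h (gradient f z) + inner l (jacobian g (at z) *v h))) (at z)"
    by (intro has_derivative_add has_derivative_inner_right)
  moreover have "inner h (gradient f z) + inner l (jacobian g (at z) *v h)
      = inner h (lagrangian_gradient f g l z)" for h
    using inner_lagrangian_gradient[OF assms(2), of f l h] by (simp add: inner_commute)
  ultimately show ?thesis
    by (simp add: gderiv_def)
qed

lemma inner_nonneg_nonpos:
  fixes l v :: "real ^ 'm"
  shows "0 \<le> l \<Longrightarrow> v \<le> 0 \<Longrightarrow> inner l v \<le> 0"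
  unfolding inner_vec_def by (auto simp: less_eq_vec_def intro!: sum_nonpos mult_nonneg_nonpos)

lemma convex_linearization_le:
  fixes g :: "real ^ 'n \<Rightarrow> real ^ 'm"
  assumes "\<And>i. convex_on UNIV (\<lambda>w. g w $ i)" and "g differentiable (at a)"
  shows "jacobian g (at a) *v (z - a) + g a \<le> g z"
  unfolding less_eq_vec_def
proof
  fix i
  have "(\<lambda>w. g w $ i) differentiable (at a)"
    using assms(2) bounded_linear.has_derivative[OF bounded_linear_vec_nth]
    unfolding differentiable_def by blast
  from convex_on_UNIV_tangent_le[OF assms(1) gderiv_gradient[OF this], of z]
  show "(jacobian g (at a) *v (z - a) + g a) $ i \<le> g z $ i"
    by (simp add: gradient_inner_jacobian[OF assms(2), symmetric] inner_commute)
qed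

lemma lagrangian_tangent_le:
  assumes f: "convex_on UNIV f" "f differentiable (at a)"
    and g: "\<And>i. convex_on UNIV (\<lambda>w. g w $ i)" "g differentiable (at a)"
    and l: "0 \<le> l"
  shows "f a + inner l (g a) + inner (lagrangian_gradient f g l a) (z - a) \<le> f z + inner l (g z)"
proof -
  have "inner l (jacobian g (at a) *v (z - a) + g a - g z) \<le> 0"
    using convex_linearization_le[OF g, of z] by (intro inner_nonneg_nonpos l) simp
  moreover have "f a + inner (gradient f a) (z - a) \<le> f z"
    by (intro convex_on_UNIV_tangent_le f gderiv_gradient)
  ultimately show ?thesis
    unfolding inner_lagrangian_gradient[OF g(2)]
    by (simp add: inner_add_right[of l] inner_diff_right[of l])
qed

text \<open>The inequality that makes the multiplier of the step harmless. For the saddle multiplier \<open>l\<close> the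
  point \<open>x\<close> minimises a strongly convex function, so that quadratic growth holds. At \<open>x\<close> no other
  multiplier \<open>l'\<close> gives a larger constraint term, and at a feasible \<open>z\<close> the constraint term is not
  positive. Thus \<open>l\<close> disappears, and the result holds for all \<open>l' \<ge> 0\<close> at once, with a right-hand
  side independent of \<open>l'\<close>.\<close>

lemma saddle_prox_inequality:
  fixes A :: "real ^ 'n ^ 'm"
  assumes u: "strongly_convex_on X \<alpha> u"
    and saddle: "is_saddle_point X {l. 0 \<le> l}
      (\<lambda>z l. (inner v z + u z + \<eta> / 2 * (norm (z - q))\<^sup>2) + inner l (A *v (z - w) + b)) x l"
    and z: "z \<in> X" "A *v (z - w) + b \<le> 0" and l': "0 \<le> l'"
  shows "inner v x + u x + \<eta> / 2 * (norm (x - q))\<^sup>2 + inner l' (A *v (x - w) + b)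
      + (\<eta> + \<alpha>) / 2 * (norm (z - x))\<^sup>2 \<le> inner v z + u z + \<eta> / 2 * (norm (z - q))\<^sup>2"
proof -
  let ?h = "\<lambda>z. inner v z + u z + \<eta> / 2 * (norm (z - q))\<^sup>2"
  let ?c = "\<lambda>z. A *v (z - w) + b"
  let ?\<psi> = "\<lambda>z. (inner (v + l v* A) z + inner l (b - A *v w) + u z) + \<eta> / 2 * (norm (z - q))\<^sup>2"
  have \<psi>: "?h z + inner l (?c z) = ?\<psi> z" for z
    by (simp add: inner_simps dot_lmul_matrix matrix_vector_mult_diff_distrib)
  have "strongly_convex_on X (\<eta> + \<alpha>) ?\<psi>"
    by (intro strongly_convex_on_add_quadratic strongly_convex_on_add_affine u)
  then have "?\<psi> x + (\<eta> + \<alpha>) / 2 * (norm (z - x))\<^sup>2 \<le> ?\<psi> z"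
    using saddle z(1) unfolding is_saddle_point_def \<psi>
    by (intro strongly_convex_on_minimizer_growth) auto
  moreover have "inner l' (?c x) \<le> inner l (?c x)"
    using saddle l' unfolding is_saddle_point_def by auto
  moreover have "inner l (?c z) \<le> 0"
    using saddle z(2) unfolding is_saddle_point_def by (intro inner_nonneg_nonpos) auto
  ultimately show ?thesis
    unfolding \<psi>[symmetric] by linarith
qed

text \<open>The KKT condition says that \<open>xs\<close> minimises over \<open>X\<close> the function obtained from the Lagrangian by
  linearising its smooth part at \<open>xs\<close>. That function inherits the strong convexity of \<open>u\<close>, lies below
  the Lagrangian, and agrees with \<open>f + u\<close> at \<open>xs\<close> by complementarity.\<close>

lemma kkt_lagrangian_growth:
  assumes f: "convex_on UNIV f" "f differentiable (at xs)"
    and g: "\<And>i. convex_on UNIV (\<lambda>w. g w $ i)" "g differentiable (at xs)"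
    and X: "convex X" "X \<subseteq> D" "strongly_convex_on D \<alpha> u"
    and kkt: "kkt_pair X D f u g xs ls" and z: "z \<in> X"
  shows "f xs + u xs + \<alpha> / 2 * (norm (z - xs))\<^sup>2 \<le> f z + u z + inner ls (g z)"
proof -
  let ?p = "lagrangian_gradient f g ls xs"
  obtain u' where u': "u' \<in> subdifferential D u xs" "- (?p + u') \<in> normal_cone X xs"
    and xs: "xs \<in> X" and ls: "0 \<le> ls" "\<And>i. ls $ i * g xs $ i = 0"
    using kkt unfolding kkt_pair_def lagrangian_gradient_def by blast
  have sc: "strongly_convex_on X \<alpha> (\<lambda>z. inner ?p z + 0 + u z)"
    using X by (intro strongly_convex_on_add_affine) (rule strongly_convex_on_subset)
  have "inner ?p xs + 0 + u xs \<le> inner ?p z + 0 + u z" if "z \<in> X" for z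
  proof -
    have "u xs + inner u' (z - xs) \<le> u z" "inner (- (?p + u')) (z - xs) \<le> 0"
      using u' that X(2) by (auto simp: subdifferential_def normal_cone_def)
    then show ?thesis
      by (simp add: inner_simps)
  qed
  from strongly_convex_on_minimizer_growth[OF sc xs this z]
  have "inner ?p xs + u xs + \<alpha> / 2 * (norm (z - xs))\<^sup>2 \<le> inner ?p z + u z"
    by simp
  moreover have "inner ls (g xs) = 0"
    by (simp add: inner_vec_def ls(2))
  ultimately show ?thesis
    using lagrangian_tangent_le[OF f g ls(1), of z] by (simp add: inner_diff_right)
qed

lemma inner_pos_part: "inner (pos_part v) v = (norm (pos_part v))\<^sup>2"
  unfolding power2_norm_eq_inner inner_vec_def
  by (intro sum.cong) (auto simp: pos_part_def max_def)

lemma pos_part_nonneg: "0 \<le> pos_part v"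
  by (simp add: pos_part_def less_eq_vec_def)

section \<open>Convergence of the method\<close>

text \<open>For a fixed multiplier the method is an accelerated gradient method for the Lagrangian, and
  \<open>accelerated_gap\<close> applies. With the average \<open>xbar\<close> itself as the reference point, the gradient terms
  \<open>inner (p xbar) (x t - xbar)\<close> have weighted sum zero, which is how a bound on the tangents at the
  points \<open>y t\<close> becomes a bound on the value at \<open>xbar\<close>.\<close>

lemma acgd_lagrangian_gap:
  fixes f u :: "real ^ 'n \<Rightarrow> real" and g :: "real ^ 'n \<Rightarrow> real ^ 'm"
  assumes f: "convex_on UNIV f" "\<And>z. f differentiable (at z)"
    and g: "\<And>i. convex_on UNIV (\<lambda>z. g z $ i)" "\<And>z. g differentiable (at z)"
    and X: "convex X" "convex_on X u" "strongly_convex_on X \<alpha> u"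
    and \<alpha>: "0 \<le> \<alpha>" "\<alpha> \<le> L"
    and l: "0 \<le> l" and lip: "L-lipschitz_on UNIV (lagrangian_gradient f g l)"
    and N: "1 \<le> N"
    and iter: "acgd_iterates X f u g (acgd_tau L \<alpha>) (acgd_eta L \<alpha>) (acgd_theta L \<alpha>) N x y"
    and z: "z \<in> X" "g z \<le> 0"
  defines "xbar \<equiv> ergodic_average (acgd_omega L \<alpha>) x N"
  shows "(\<Sum>t=1..N. acgd_omega L \<alpha> t) * (f xbar + u xbar + inner l (g xbar) - (f z + u z))
    \<le> L * (norm (x 0 - z))\<^sup>2"
proof -
  let ?\<phi> = "\<lambda>w. f w + inner l (g w)" and ?p = "lagrangian_gradient f g l"
  let ?\<omega> = "acgd_omega L \<alpha>" and ?\<tau> = "acgd_tau L \<alpha>" and ?\<eta> = "acgd_eta L \<alpha>" and ?\<theta> = "acgd_theta L \<alpha>"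
  define S where "S = (\<Sum>t=1..N. ?\<omega> t)"
  have \<omega>: "0 < ?\<omega> t" if "t \<in> {1..N}" for t
    using acgd_omega_pos \<alpha> that by simp
  have S: "0 < S"
    unfolding S_def using N \<omega> by (intro sum_pos) auto
  let ?q = "\<lambda>t z. inner (gradient f (y t)) z + u z + ?\<eta> t / 2 * (norm (z - x (t - 1)))\<^sup>2"
  let ?c = "\<lambda>t z. jacobian g (at (y t)) *v (z - y t) + g (y t)"
  have iter_y: "y t = (?\<tau> t *\<^sub>R y (t - 1) + (x (t - 1) + ?\<theta> t *\<^sub>R (x (t - 1) - x (t - 2)))) /\<^sub>R (1 + ?\<tau> t)"
    and iter_saddle: "\<exists>l. is_saddle_point X {l. 0 \<le> l} (\<lambda>z l. ?q t z + inner l (?c t z)) (x t) l"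
    if "t \<in> {1..N}" for t
    using iter that unfolding acgd_iterates_def Let_def by blast+
  have xX: "x t \<in> X" if "t \<in> {1..N}" for t
    using iter_saddle[OF that] unfolding is_saddle_point_def by blast
  have y: "(1 + ?\<tau> t) *\<^sub>R y t = ?\<tau> t *\<^sub>R y (t - 1) + (x (t - 1) + ?\<theta> t *\<^sub>R (x (t - 1) - x (t - 2)))"
    if t: "t \<in> {1..N}" for t
  proof -
    have "1 + ?\<tau> t \<noteq> 0"
      using acgd_tau_nonneg[of L \<alpha> t] \<alpha> t by auto
    then show ?thesis
      by (subst iter_y[OF t]) simp
  qed
  have prox: "?\<phi> (y t) + inner (?p (y t)) (x t - y t) + (u (x t) - (f z + u z))
      + ?\<eta> t / 2 * (norm (x t - x (t - 1)))\<^sup>2 + (?\<eta> t + \<alpha>) / 2 * (norm (z - x t))\<^sup>2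
      \<le> ?\<eta> t / 2 * (norm (z - x (t - 1)))\<^sup>2" if t: "t \<in> {1..N}" for t
  proof -
    obtain l' where "is_saddle_point X {l. 0 \<le> l} (\<lambda>z l. ?q t z + inner l (?c t z)) (x t) l'"
      using iter_saddle[OF t] ..
    moreover have "?c t z \<le> 0"
      using convex_linearization_le[OF g, of "y t" z] z(2) by (rule order_trans)
    ultimately have "?q t (x t) + inner l (?c t (x t)) + (?\<eta> t + \<alpha>) / 2 * (norm (z - x t))\<^sup>2 \<le> ?q t z"
      by (intro saddle_prox_inequality[OF X(3) _ z(1) _ l])
    moreover have "f (y t) + inner (gradient f (y t)) (z - y t) \<le> f z"
      by (intro convex_on_UNIV_tangent_le f gderiv_gradient)
    ultimately show ?thesis
      unfolding inner_lagrangian_gradient[OF g(2)] inner_add_right[of l] inner_diff_right[of "gradient f (y t)"]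
      by linarith
  qed
  have "(\<Sum>t=1..N. ?\<omega> t * (?\<phi> xbar + inner (?p xbar) (x t - xbar) + (u (x t) - (f z + u z))))
      + ?\<omega> N * (?\<eta> N + \<alpha>) / 2 * (norm (z - x N))\<^sup>2 \<le> ?\<omega> 1 * ?\<eta> 1 / 2 * (norm (z - x 0))\<^sup>2"
  proof (rule accelerated_gap[where \<tau> = ?\<tau> and \<theta> = ?\<theta> and y = y and L = L])
    show "?\<phi> a + inner (?p a) (w - a) \<le> ?\<phi> w" for a w
      by (intro lagrangian_tangent_le f g l)
    show "?\<phi> (b + w) \<le> ?\<phi> b + inner (?p b) w + L / 2 * (norm w)\<^sup>2" for b w
      by (intro lipschitz_gradient_upper_bound gderiv_lagrangian f g lip)
    show "?\<tau> 1 = 0" "?\<theta> 1 = 0"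
      using \<alpha> by (simp_all add: acgd_tau_def acgd_theta_def)
  qed (use y prox acgd_tau_nonneg acgd_omega_pos acgd_omega_tau acgd_omega_theta acgd_omega_eta
        acgd_eta_ge \<alpha> N in auto)
  moreover have "(\<Sum>t=1..N. ?\<omega> t * (?\<phi> xbar + inner (?p xbar) (x t - xbar) + (u (x t) - (f z + u z))))
      = S * (?\<phi> xbar - (f z + u z)) + (\<Sum>t=1..N. ?\<omega> t * u (x t))"
  proof -
    have "(\<Sum>t=1..N. ?\<omega> t * (?\<phi> xbar + inner (?p xbar) (x t - xbar) + (u (x t) - (f z + u z))))
      = (\<Sum>t=1..N. ?\<omega> t * (?\<phi> xbar - (f z + u z)) + ?\<omega> t * inner (?p xbar) (x t - xbar) + ?\<omega> t * u (x t))"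
      by (intro sum.cong) (auto simp: algebra_simps)
    also have "\<dots> = S * (?\<phi> xbar - (f z + u z)) + (\<Sum>t=1..N. ?\<omega> t * u (x t))"
      using sum_inner_ergodic_average_eq_0[of ?\<omega> N "?p xbar" x] S
      by (simp add: sum.distrib S_def xbar_def sum_distrib_right)
    finally show ?thesis .
  qed
  moreover have "S * u xbar \<le> (\<Sum>t=1..N. ?\<omega> t * u (x t))"
    unfolding S_def xbar_def by (intro convex_on_ergodic_average_le[OF X(2)] \<omega> xX N)
  moreover have "0 \<le> ?\<omega> N * (?\<eta> N + \<alpha>) / 2 * (norm (z - x N))\<^sup>2"
    using \<omega>[of N] N \<alpha> acgd_tau_nonneg[of L \<alpha> "N + 1"] by (simp add: acgd_eta_def)
  \<comment> \<open>No cap is active here, as \<open>L \<ge> \<alpha>\<close>; hence \<open>\<tau> 2 = 1 / 2\<close> and \<open>\<eta> 1 = 2 L\<close>.\<close>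
  moreover have "?\<omega> 1 * ?\<eta> 1 / 2 * (norm (z - x 0))\<^sup>2 = L * (norm (x 0 - z))\<^sup>2"
  proof -
    have "?\<tau> 2 = 1 / 2"
    proof (cases "\<alpha> = 0")
      case False
      then have "1 / 2 \<le> sqrt (L / \<alpha>)"
        using sqrt_condition_number(1)[of \<alpha> L] \<alpha> by linarith
      with False show ?thesis
        by (simp add: acgd_tau_def min_absorb1)
    qed (simp add: acgd_tau_def)
    then show ?thesis
      by (simp add: acgd_eta_def numeral_2_eq_2 norm_minus_commute)
  qed
  ultimately have "S * (?\<phi> xbar - (f z + u z)) + S * u xbar \<le> L * (norm (x 0 - z))\<^sup>2"
    by linarith
  moreover have "S * (f xbar + u xbar + inner l (g xbar) - (f z + u z))
      = S * (?\<phi> xbar - (f z + u z)) + S * u xbar"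
    by (simp add: algebra_simps)
  ultimately show ?thesis
    by (simp only: S_def)
qed


theorem theorem1:
  fixes X D :: "(real ^ 'n) set"
    and f u F :: "real ^ 'n \<Rightarrow> real"
    and g :: "real ^ 'n \<Rightarrow> real ^ 'm"
    and \<alpha> r L \<kappa> :: real
    and Lc :: "real ^ 'm \<Rightarrow> real"
    and xs :: "real ^ 'n" and ls :: "real ^ 'm"
    and x y :: "nat \<Rightarrow> real ^ 'n"
    and xbar :: "real ^ 'n"
    and N :: nat
  assumes "closed X" and "convex X"
    and "convex_on UNIV f" and "\<And>z. f differentiable (at z)"
    and "\<exists>C. C-lipschitz_on UNIV (gradient f)"
    and "\<And>i. convex_on UNIV (\<lambda>z. g z $ i)" and "\<And>z. g differentiable (at z)"
    and "\<And>i. \<exists>C. C-lipschitz_on UNIV (gradient (\<lambda>z. g z $ i))"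
    and "X \<subseteq> D" and "convex_on D u" and "0 \<le> \<alpha>" and "strongly_convex_on D \<alpha> u"
    and F_eq: "F = (\<lambda>z. f z + u z)"
    and "is_arg_min F (\<lambda>z. z \<in> X \<and> g z \<le> 0) xs"
    and "kkt_pair X D f u g xs ls"
    and "aggregate_lipschitz f g Lc" and "\<alpha> \<le> Lc 0"
    and "0 < r"
    and "bdd_above (Lc ` multiplier_set ls r)"
    and L_eq: "L = (SUP l\<in>multiplier_set ls r. Lc l)"
    and \<kappa>_eq: "\<kappa> = L / \<alpha>"
    and "1 \<le> N"
    and "acgd_iterates X f u g (acgd_tau L \<alpha>) (acgd_eta L \<alpha>) (acgd_theta L \<alpha>) N x y"
    and xbar_eq: "xbar = ergodic_average (acgd_omega L \<alpha>) x N"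
  shows "max (F xbar - F xs) (r * norm (pos_part (g xbar)))
           \<le> 2 * L / (real N * (real N + 1)) * (norm (x 0 - xs))\<^sup>2
       \<and> (0 < \<alpha> \<and> 5 \<le> N \<longrightarrow>
           max (F xbar - F xs) (r * norm (pos_part (g xbar)))
             \<le> sqrt (L * \<alpha>) * (norm (x 0 - xs))\<^sup>2 / ((1 + 1 / sqrt \<kappa>) ^ (N - 4) - 1)
         \<and> (norm (xbar - xs))\<^sup>2
             \<le> 2 * sqrt \<kappa> * (norm (x 0 - xs))\<^sup>2 / ((1 + 1 / sqrt \<kappa>) ^ (N - 4) - 1))"
proof -
  let ?\<omega> = "acgd_omega L \<alpha>"
  define S where "S = (\<Sum>t=1..N. ?\<omega> t)"
  define B where "B = L * (norm (x 0 - xs))\<^sup>2"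
  define V where "V = max (F xbar - F xs) (r * norm (pos_part (g xbar)))"
  note f = \<open>convex_on UNIV f\<close> \<open>\<And>z. f differentiable (at z)\<close>
    and g = \<open>\<And>i. convex_on UNIV (\<lambda>z. g z $ i)\<close> \<open>\<And>z. g differentiable (at z)\<close>
    and kkt = \<open>kkt_pair X D f u g xs ls\<close>
  have xs: "xs \<in> X" "g xs \<le> 0" and ls: "0 \<le> ls"
    using kkt unfolding kkt_pair_def by auto
  have u: "convex_on X u" "strongly_convex_on X \<alpha> u"
    by (rule convex_on_subset[OF \<open>convex_on D u\<close> \<open>X \<subseteq> D\<close> \<open>convex X\<close>])
      (rule strongly_convex_on_subset[OF \<open>strongly_convex_on D \<alpha> u\<close> \<open>X \<subseteq> D\<close> \<open>convex X\<close>])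
  have Lc_le: "Lc l \<le> L" if "l \<in> multiplier_set ls r" for l
    unfolding L_eq using that \<open>bdd_above (Lc ` multiplier_set ls r)\<close> by (rule cSUP_upper)
  \<comment> \<open>The supremum includes the multiplier \<open>0\<close>, that is, the Lipschitz constant for \<open>f\<close> alone.\<close>
  have "\<alpha> \<le> L"
    using Lc_le[of 0] \<open>\<alpha> \<le> Lc 0\<close> by (simp add: multiplier_set_def)
  note \<alpha> = \<open>0 \<le> \<alpha>\<close> this
  have S: "0 < S"
    unfolding S_def using \<open>1 \<le> N\<close> acgd_omega_pos \<alpha> by (intro sum_pos) auto
  have B: "0 \<le> B"
    using \<alpha> by (simp add: B_def)
  have xbar: "xbar \<in> X"
    unfolding xbar_eq using \<open>acgd_iterates X f u g _ _ _ N x y\<close> \<open>convex X\<close> \<open>1 \<le> N\<close> acgd_omega_pos \<alpha>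
    by (intro ergodic_average_in_convex) (auto simp: acgd_iterates_def Let_def is_saddle_point_def)
  have gap: "F xbar + inner l (g xbar) - F xs \<le> B / S" if l: "l \<in> multiplier_set ls r" for l
  proof -
    have "0 \<le> l"
      using l ls by (auto simp: multiplier_set_def)
    have "lagrangian_gradient f g l = gradient (\<lambda>z. f z + (\<Sum>i\<in>UNIV. l $ i * g z $ i))"
    proof
      fix z
      show "lagrangian_gradient f g l z = gradient (\<lambda>z. f z + (\<Sum>i\<in>UNIV. l $ i * g z $ i)) z"
        using gradient_eqI[OF gderiv_lagrangian[OF f(2) g(2)], of l z] by (simp add: inner_vec_def)
    qed
    moreover have "(Lc l)-lipschitz_on UNIV (gradient (\<lambda>z. f z + (\<Sum>i\<in>UNIV. l $ i * g z $ i)))"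
      using \<open>aggregate_lipschitz f g Lc\<close> \<open>0 \<le> l\<close> unfolding aggregate_lipschitz_def by blast
    ultimately have "L-lipschitz_on UNIV (lagrangian_gradient f g l)"
      using lipschitz_on_le[OF _ Lc_le[OF l]] by simp
    from acgd_lagrangian_gap[OF f g \<open>convex X\<close> u \<alpha> \<open>0 \<le> l\<close> this \<open>1 \<le> N\<close> \<open>acgd_iterates X f u g _ _ _ N x y\<close> xs]
    have "S * (F xbar + inner l (g xbar) - F xs) \<le> B"
      by (simp add: S_def B_def F_eq xbar_eq algebra_simps)
    then show ?thesis
      using S by (simp add: pos_le_divide_eq mult.commute)
  qed
  have growth: "F xs + \<alpha> / 2 * (norm (xbar - xs))\<^sup>2 \<le> F xbar + inner ls (g xbar)"
    using kkt_lagrangian_growth[OF f g \<open>convex X\<close> \<open>X \<subseteq> D\<close> \<open>strongly_convex_on D \<alpha> u\<close> kkt xbar]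
    by (simp add: F_eq)
  have "r * norm (pos_part (g xbar)) \<le> B / S"
  proof (cases "pos_part (g xbar) = 0")
    case True
    then show ?thesis
      using B S by simp
  next
    case False
    let ?v = "pos_part (g xbar)"
    \<comment> \<open>The vector of norm \<open>r\<close> in the direction of the violation, shifted by \<open>ls\<close>: the shift pays for
      a possible value of \<open>F xbar\<close> below the optimum.\<close>
    define l' where "l' = (r / norm ?v) *\<^sub>R ?v"
    have "0 \<le> l'" "norm l' \<le> r"
      using \<open>0 < r\<close> False pos_part_nonneg[of "g xbar"]
      by (auto simp: l'_def less_eq_vec_def)
    then have "ls + l' \<in> multiplier_set ls r"
      unfolding multiplier_set_def by blast
    from gap[OF this] have "F xbar + inner ls (g xbar) + inner l' (g xbar) - F xs \<le> B / S"
      by (simp add: inner_add_left)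
    moreover have "inner l' (g xbar) = r * norm ?v"
      using False by (simp add: l'_def inner_pos_part power2_eq_square)
    moreover have "0 \<le> \<alpha> / 2 * (norm (xbar - xs))\<^sup>2"
      using \<alpha> by simp
    ultimately show ?thesis
      using growth by linarith
  qed
  moreover have "F xbar - F xs \<le> B / S"
    using gap[of 0] by (simp add: multiplier_set_def)
  ultimately have V: "V \<le> B / S"
    by (simp add: V_def)
  have dist: "\<alpha> / 2 * (norm (xbar - xs))\<^sup>2 \<le> B / S"
  proof -
    have "ls \<in> multiplier_set ls r"
      using \<open>0 < r\<close> by (auto simp: multiplier_set_def intro!: exI[of _ 0])
    from gap[OF this] growth show ?thesis
      by linarith
  qed
  have "B / S \<le> B / (real N * (real N + 1) / 2)"
    using sum_acgd_omega_ge[OF \<alpha>, of N] S B \<open>1 \<le> N\<close> by (intro divide_left_mono) (auto simp: S_def)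
  with V have sublinear: "V \<le> 2 * L / (real N * (real N + 1)) * (norm (x 0 - xs))\<^sup>2"
    by (simp add: B_def mult_ac)
  have linear: "V \<le> sqrt (L * \<alpha>) * (norm (x 0 - xs))\<^sup>2 / ((1 + 1 / sqrt \<kappa>) ^ (N - 4) - 1)"
    (is ?V) and linear_dist:
    "(norm (xbar - xs))\<^sup>2 \<le> 2 * sqrt \<kappa> * (norm (x 0 - xs))\<^sup>2 / ((1 + 1 / sqrt \<kappa>) ^ (N - 4) - 1)"
    (is ?D) if "0 < \<alpha>" "5 \<le> N"
  proof -
    define s where "s = sqrt \<kappa>"
    define W where "W = (1 + 1 / s) ^ (N - 4) - 1"
    have s: "1 \<le> s" and L: "L = \<alpha> * s\<^sup>2"
      using sqrt_condition_number[of \<alpha> L] that \<alpha> by (auto simp: s_def \<kappa>_eq)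
    have W: "0 < W"
      using s that by (simp add: W_def one_less_power)
    have "s * W \<le> S"
      using sum_acgd_omega_ge_geometric[of \<alpha> L N] that \<alpha> by (simp add: s_def W_def S_def \<kappa>_eq)
    then have "B / S \<le> B / (s * W)"
      using s W S B by (intro divide_left_mono) auto
    also have "\<dots> = \<alpha> * s * (norm (x 0 - xs))\<^sup>2 / W"
      using s by (simp add: B_def L power2_eq_square)
    finally have BS: "B / S \<le> \<alpha> * s * (norm (x 0 - xs))\<^sup>2 / W" .
    have "sqrt (L * \<alpha>) = \<alpha> * s"
      using s \<alpha> by (simp add: L real_sqrt_mult)
    then show ?V
      using V BS by (simp add: W_def s_def)
    have "\<alpha> * (norm (xbar - xs))\<^sup>2 \<le> 2 * (\<alpha> * s * (norm (x 0 - xs))\<^sup>2 / W)"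
      using dist BS by linarith
    also have "\<dots> = \<alpha> * (2 * s * (norm (x 0 - xs))\<^sup>2 / W)"
      by simp
    finally have "\<alpha> * (norm (xbar - xs))\<^sup>2 \<le> \<alpha> * (2 * s * (norm (x 0 - xs))\<^sup>2 / W)" .
    then show ?D
      unfolding mult_le_cancel_left_pos[OF \<open>0 < \<alpha>\<close>] W_def s_def .
  qed
  show ?thesis
    using sublinear linear linear_dist unfolding V_def by blast
qed

end
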